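(* Let $F$ be a field with $\operatorname{char}(F)\neq 2$ and let $L$ be a finite dimensional nilpotent Lie algebra over $F$ with center $Z(L)$. Then $b(L)=2$ if and only if one of the following conditions holds: (1) $\dim[L,L]=2$; or (2) $\dim[L,L]=3$ and $\dim(L/Z(L))=3$.
   Context: For a finite dimensional Lie algebra $L$ and $x\in L$, $\operatorname{ad}_x:L\to L$ denotes the map $y\mapsto [x,y]$. The breadth of $L$ is $b(L)=\max\{\operatorname{rank}(\operatorname{ad}_x)\mid x\in L\}$. *)

theory Defs
  imports
    Complex_Main
    "HOL-Library.Set_Algebras"
begin

definition quotient_space :: "'a::ab_group_add set \<Rightarrow> 'a set set"
  where "quotient_space W = range (\<lambda>x. x +o W)"

text \<open>
  The linear combination of the cosets \<open>A \<in> \<B>\<close> with coefficients \<open>c A\<close>, computed in the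
  quotient by the subspace \<open>W\<close>. Sums of cosets are elementwise sums of sets. The summand \<open>W\<close> is
  the zero of the quotient; it is needed because the elementwise multiple of a coset by \<open>0\<close> is
  \<open>{0}\<close>, not \<open>W\<close>, and because the empty sum of sets is \<open>{0}\<close>.
\<close>

definition quotient_comb ::
  "('f::field \<Rightarrow> 'a::ab_group_add \<Rightarrow> 'a) \<Rightarrow> 'a set \<Rightarrow> 'a set set \<Rightarrow> ('a set \<Rightarrow> 'f) \<Rightarrow> 'a set"
  where "quotient_comb scale W \<B> c = (\<Sum>A\<in>\<B>. scale (c A) ` A) + W"

definition quotient_basis ::
  "('f::field \<Rightarrow> 'a::ab_group_add \<Rightarrow> 'a) \<Rightarrow> 'a set \<Rightarrow> 'a set set \<Rightarrow> bool"
  where "quotient_basis scale W \<B> \<longleftrightarrow>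
    finite \<B> \<and> \<B> \<subseteq> quotient_space W \<and>
    (\<forall>c. quotient_comb scale W \<B> c = W \<longrightarrow> (\<forall>A\<in>\<B>. c A = 0)) \<and>
    (\<forall>X\<in>quotient_space W. \<exists>c. X = quotient_comb scale W \<B> c)"

text \<open>Meaningful only if the quotient has finite dimension.\<close>

definition quotient_dim :: "('f::field \<Rightarrow> 'a::ab_group_add \<Rightarrow> 'a) \<Rightarrow> 'a set \<Rightarrow> nat"
  where "quotient_dim scale W = card (SOME \<B>. quotient_basis scale W \<B>)"

locale lie_algebra = vector_space scale
  for scale :: "'f::field \<Rightarrow> 'a::ab_group_add \<Rightarrow> 'a" (infixr \<open>*s\<close> 75) +
  fixes bracket :: "'a \<Rightarrow> 'a \<Rightarrow> 'a"
  assumes linear_left: "Vector_Spaces.linear scale scale (\<lambda>x. bracket x y)"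
    and linear_right: "Vector_Spaces.linear scale scale (\<lambda>y. bracket x y)"
    and bracket_self: "bracket x x = 0"
    and jacobi: "bracket x (bracket y z) + bracket y (bracket z x) + bracket z (bracket x y) = 0"
begin

definition ad :: "'a \<Rightarrow> 'a \<Rightarrow> 'a"
  where "ad x = (\<lambda>y. bracket x y)"

definition center :: "'a set"
  where "center = {z. \<forall>x. bracket z x = 0}"

definition bracket_space :: "'a set \<Rightarrow> 'a set \<Rightarrow> 'a set"
  where "bracket_space A B = span {bracket a b | a b. a \<in> A \<and> b \<in> B}"

definition derived_algebra :: "'a set"
  where "derived_algebra = bracket_space UNIV UNIV"

primrec lower_central_series :: "nat \<Rightarrow> 'a set" where
  "lower_central_series 0 = UNIV"
| "lower_central_series (Suc n) = bracket_space UNIV (lower_central_series n)"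

definition nilpotent :: bool
  where "nilpotent \<longleftrightarrow> (\<exists>n. lower_central_series n = {0})"

end

locale finite_dimensional_lie_algebra = lie_algebra +
  assumes finite_dimensional: "\<exists>B. finite_dimensional_vector_space scale B"
begin

definition breadth :: nat
  where "breadth = Max {dim (range (ad x)) | x. True}"

end

text \<open>The dimension of the quotient is well defined and agrees with the codimension.\<close>

context finite_dimensional_vector_space
begin

lemma coset_eq_iff:
  assumes "subspace W"
  shows "x +o W = y +o W \<longleftrightarrow> x - y \<in> W"
proof
  assume "x +o W = y +o W"
  moreover have "x \<in> x +o W"
    using subspace_0[OF assms] by (force simp: elt_set_plus_def)
  ultimately obtain w where "w \<in> W" "x = y + w"
    by (auto simp: elt_set_plus_def)
  then show "x - y \<in> W" by simp
next
  assume d: "x - y \<in> W"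
  show "x +o W = y +o W"
  proof (intro equalityI subsetI)
    fix z assume "z \<in> x +o W"
    then obtain w where w: "w \<in> W" "z = x + w" by (auto simp: elt_set_plus_def)
    then have "z = y + ((x - y) + w)" by simp
    moreover have "(x - y) + w \<in> W" using assms d w(1) by (rule subspace_add)
    ultimately show "z \<in> y +o W" unfolding elt_set_plus_def by blast
  next
    fix z assume "z \<in> y +o W"
    then obtain w where w: "w \<in> W" "z = y + w" by (auto simp: elt_set_plus_def)
    then have "z = x + (w - (x - y))" by simp
    moreover have "w - (x - y) \<in> W" using assms w(1) d by (rule subspace_diff)
    ultimately show "z \<in> x +o W" unfolding elt_set_plus_def by blast
  qed
qed

lemma coset_eq_self_iff:
  assumes "subspace W"
  shows "x +o W = W \<longleftrightarrow> x \<in> W"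
  using coset_eq_iff[OF assms, of x 0] by (simp add: elt_set_plus_def)

lemma quotient_comb_eq_coset:
  assumes "subspace W" "finite \<B>" "\<And>A. A \<in> \<B> \<Longrightarrow> A = r A +o W"
  shows "quotient_comb scale W \<B> c = (\<Sum>A\<in>\<B>. c A *s r A) +o W"
proof -
  have WW: "W + W = W"
  proof (intro equalityI subsetI)
    fix x assume "x \<in> W + W"
    then show "x \<in> W" using assms(1) by (auto simp: set_plus_def subspace_add)
  next
    fix x assume "x \<in> W"
    then have "x + 0 \<in> W + W" using subspace_0[OF assms(1)] by (rule set_plus_intro)
    then show "x \<in> W + W" by simp
  qed
  have scl: "(*s) k ` (x +o W) + W = (k *s x) +o W" for k x
  proof (intro equalityI subsetI)
    fix y assume "y \<in> (*s) k ` (x +o W) + W"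
    then obtain w v where *: "w \<in> W" "v \<in> W" "y = k *s (x + w) + v"
      by (auto simp: set_plus_def elt_set_plus_def)
    then have "y = k *s x + (k *s w + v)" by (simp add: scale_right_distrib add.assoc)
    moreover have "k *s w + v \<in> W"
      using assms(1) * by (intro subspace_add subspace_scale)
    ultimately show "y \<in> (k *s x) +o W" by (auto simp: elt_set_plus_def)
  next
    fix y assume "y \<in> (k *s x) +o W"
    then obtain w where w: "w \<in> W" "y = k *s x + w" by (auto simp: elt_set_plus_def)
    have "x \<in> x +o W" using subspace_0[OF assms(1)] by (force simp: elt_set_plus_def)
    with w show "y \<in> (*s) k ` (x +o W) + W" by (auto simp: set_plus_def)
  qed
  have "(\<Sum>A\<in>\<B>. (*s) (c A) ` A) + W = (\<Sum>A\<in>\<B>. c A *s r A) +o W"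
    using assms(2,3)
  proof (induction \<B> rule: finite_induct)
    case empty
    then show ?case by (simp add: elt_set_plus_def)
  next
    case (insert X \<B>)
    let ?S = "\<Sum>A\<in>\<B>. (*s) (c A) ` A" and ?Y = "(*s) (c X) ` X"
    have X: "X = r X +o W" using insert.prems by blast
    have Y: "?Y + W = (c X *s r X) +o W" by (subst X) (rule scl)
    have IH: "?S + W = (\<Sum>A\<in>\<B>. c A *s r A) +o W" using insert.IH insert.prems by blast
    have "(\<Sum>A\<in>insert X \<B>. (*s) (c A) ` A) + W = (?Y + ?S) + (W + W)"
      unfolding WW using insert.hyps by simp
    also have "\<dots> = (?Y + W) + (?S + W)" by (simp only: ac_simps)
    also have "\<dots> = (\<Sum>A\<in>insert X \<B>. c A *s r A) +o W"
      unfolding Y IH using insert.hyps WW by (simp add: set_plus_rearrange)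
    finally show ?case .
  qed
  then show ?thesis by (simp add: quotient_comb_def)
qed

lemma card_quotient_basis:
  assumes W: "subspace W" and B: "quotient_basis scale W \<B>"
  shows "dim W + card \<B> = dim UNIV"
proof -
  have fin: "finite \<B>" using B by (simp add: quotient_basis_def)
  define r where "r A = (SOME x. A = x +o W)" for A
  have r: "A = r A +o W" if "A \<in> \<B>" for A
  proof -
    have "\<exists>x. A = x +o W" using B that by (auto simp: quotient_basis_def quotient_space_def)
    then show ?thesis unfolding r_def by (rule someI_ex)
  qed
  have indep: "\<forall>A\<in>\<B>. c A = 0" if "quotient_comb scale W \<B> c = W" for c
    using B that unfolding quotient_basis_def by (elim conjE allE[of _ c]) simp
  have gen: "\<exists>c. x +o W = quotient_comb scale W \<B> c" for x
    using B unfolding quotient_basis_def quotient_space_def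
    by (elim conjE ballE[of _ _ "x +o W"]) simp_all
  have comb: "quotient_comb scale W \<B> c = (\<Sum>A\<in>\<B>. c A *s r A) +o W" for c
    using W fin r by (rule quotient_comb_eq_coset)
  have inj: "inj_on r \<B>" 
  proof (rule inj_onI)
    fix A A' assume "A \<in> \<B>" "A' \<in> \<B>" "r A = r A'"
    then show "A = A'" using r[of A] r[of A'] by simp
  qed
  have finC: "finite (r ` \<B>)" using fin by simp
  have zero: "\<forall>v\<in>r ` \<B>. u v = 0" if "(\<Sum>v\<in>r ` \<B>. u v *s v) \<in> W" for u
  proof -
    have "(\<Sum>A\<in>\<B>. u (r A) *s r A) \<in> W" using that by (simp add: sum.reindex[OF inj])
    then have "quotient_comb scale W \<B> (\<lambda>A. u (r A)) = W"
      by (simp add: comb coset_eq_self_iff[OF W])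
    then have "\<forall>A\<in>\<B>. u (r A) = 0" by (rule indep)
    then show ?thesis by blast
  qed
  have ind: "independent (r ` \<B>)"
    using zero subspace_0[OF W] by (auto simp: dependent_finite[OF finC])
  let ?U = "span (r ` \<B>)"
  have int: "W \<inter> ?U = {0}"
  proof (intro equalityI subsetI)
    fix x assume x: "x \<in> W \<inter> ?U"
    then obtain u where u: "x = (\<Sum>v\<in>r ` \<B>. u v *s v)" by (auto simp: span_finite[OF finC])
    with x zero[of u] have "\<forall>v\<in>r ` \<B>. u v = 0" by blast
    with u show "x \<in> {0}" by simp
  qed (simp add: subspace_0[OF W] span_zero)
  have sum: "{x + y |x y. x \<in> W \<and> y \<in> ?U} = UNIV"
  proof -
    have "\<exists>w u. x = w + u \<and> w \<in> W \<and> u \<in> ?U" for x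
    proof -
      obtain c where "x +o W = quotient_comb scale W \<B> c"
        by (rule exE[OF gen])
      then have "x - (\<Sum>A\<in>\<B>. c A *s r A) \<in> W" by (simp add: comb coset_eq_iff[OF W])
      moreover have "(\<Sum>A\<in>\<B>. c A *s r A) \<in> ?U"
        by (intro span_sum span_scale span_base) auto
      moreover have "x = (x - (\<Sum>A\<in>\<B>. c A *s r A)) + (\<Sum>A\<in>\<B>. c A *s r A)" by simp
      ultimately show ?thesis by blast
    qed
    then show ?thesis by blast
  qed
  have "dim ?U = card \<B>"
    using ind inj by (simp add: dim_eq_card_independent card_image)
  moreover have "dim {x + y |x y. x \<in> W \<and> y \<in> ?U} + dim (W \<inter> ?U) = dim W + dim ?U"
    using W by (intro dim_sums_Int) simp_all
  moreover have "dim {0} = 0" by (subst dim_eq_0) simp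
  ultimately show ?thesis by (simp only: int sum)
qed

lemma quotient_basis_exists:
  assumes W: "subspace W"
  shows "\<exists>\<B>. quotient_basis scale W \<B>"
proof -
  obtain B0 where B0: "B0 \<subseteq> W" "independent B0" "W \<subseteq> span B0"
    using maximal_independent_subset by metis
  have W_span: "W = span B0" using B0 W by (simp add: span_subspace)
  obtain E where E: "B0 \<subseteq> E" "independent E" "UNIV \<subseteq> span E"
    using maximal_independent_subset_extend[OF subset_UNIV B0(2)] by metis
  define D where "D = E - B0"
  have finE: "finite E" using E(2) by (rule finiteI_independent)
  have finD: "finite D" and finB0: "finite B0" and dis: "D \<inter> B0 = {}" and un: "D \<union> B0 = E"
    using finE E(1) by (auto simp: D_def intro: finite_subset)
  have zero: "\<forall>v\<in>D. u v = 0" if u: "(\<Sum>v\<in>D. u v *s v) \<in> W" for u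
  proof -
    obtain t where t: "(\<Sum>v\<in>D. u v *s v) = (\<Sum>v\<in>B0. t v *s v)"
      using u by (auto simp: W_span span_finite[OF finB0])
    define q where "q v = (if v \<in> D then u v else - t v)" for v
    have "(\<Sum>v\<in>E. q v *s v) = (\<Sum>v\<in>D. q v *s v) + (\<Sum>v\<in>B0. q v *s v)"
      unfolding un[symmetric] by (rule sum.union_disjoint[OF finD finB0 dis])
    also have "(\<Sum>v\<in>D. q v *s v) = (\<Sum>v\<in>D. u v *s v)"
      by (rule sum.cong) (simp_all add: q_def)
    also have "(\<Sum>v\<in>B0. q v *s v) = (\<Sum>v\<in>B0. - (t v *s v))"
      using dis by (intro sum.cong) (auto simp: q_def)
    finally have "(\<Sum>v\<in>E. q v *s v) = 0" by (simp add: t sum_negf)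
    then have "\<forall>v\<in>E. q v = 0" using E(2) unfolding dependent_finite[OF finE] by blast
    then show ?thesis using un by (metis UnI1 q_def)
  qed
  define k where "k x = x +o W" for x
  have inj: "inj_on k D"
  proof (rule inj_onI, rule ccontr)
    fix x y assume xy: "x \<in> D" "y \<in> D" "k x = k y" "x \<noteq> y"
    define u where "u v = (if v = x then 1 else if v = y then -1 else (0::'a))" for v
    have "(\<Sum>v\<in>D. u v *s v) = (\<Sum>v\<in>{x, y}. u v *s v)"
      using xy finD by (intro sum.mono_neutral_right) (auto simp: u_def)
    also have "\<dots> = x - y" using xy(4) by (simp add: u_def)
    also have "\<dots> \<in> W" using xy(3) by (simp add: k_def coset_eq_iff[OF W])
    finally have "\<forall>v\<in>D. u v = 0" by (rule zero)
    then show False using xy(1) by (auto simp: u_def)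
  qed
  define r where "r = inv_into D k"
  have rk: "r (k x) = x" if "x \<in> D" for x using inj that by (simp add: r_def)
  have r: "A = r A +o W" if "A \<in> k ` D" for A using that rk by (auto simp: k_def)
  have fin: "finite (k ` D)" using finD by simp
  have comb: "quotient_comb scale W (k ` D) c = (\<Sum>v\<in>D. c (k v) *s v) +o W" for c
  proof -
    have "quotient_comb scale W (k ` D) c = (\<Sum>A\<in>k ` D. c A *s r A) +o W"
      by (rule quotient_comb_eq_coset[OF W fin r])
    also have "(\<Sum>A\<in>k ` D. c A *s r A) = (\<Sum>v\<in>D. c (k v) *s v)"
      using rk by (simp add: sum.reindex[OF inj])
    finally show ?thesis .
  qed
  have "quotient_basis scale W (k ` D)"
    unfolding quotient_basis_def
  proof (intro conjI allI impI ballI)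
    show "finite (k ` D)" by (rule fin)
    show "k ` D \<subseteq> quotient_space W" by (auto simp: quotient_space_def k_def)
  next
    fix c A assume "quotient_comb scale W (k ` D) c = W" and A: "A \<in> k ` D"
    then have "(\<Sum>v\<in>D. c (k v) *s v) \<in> W" by (simp add: comb coset_eq_self_iff[OF W])
    then have "\<forall>v\<in>D. c (k v) = 0" by (rule zero)
    then show "c A = 0" using A by blast
  next
    fix X assume "X \<in> quotient_space W"
    then obtain x where X: "X = x +o W" by (auto simp: quotient_space_def)
    have "x \<in> span (D \<union> B0)" using E(3) unfolding un by blast
    then obtain d w where dw: "x = d + w" "d \<in> span D" "w \<in> W"
      unfolding span_Un W_span by blast
    then obtain u where u: "d = (\<Sum>v\<in>D. u v *s v)" by (auto simp: span_finite[OF finD])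
    have "quotient_comb scale W (k ` D) (\<lambda>A. u (r A)) = (\<Sum>v\<in>D. u (r (k v)) *s v) +o W"
      by (rule comb)
    also have "(\<Sum>v\<in>D. u (r (k v)) *s v) = d" unfolding u using rk by (intro sum.cong) simp_all
    also have "d +o W = X" unfolding X using dw
      by (subst coset_eq_iff[OF W]) (simp add: subspace_neg[OF W])
    finally show "\<exists>c. X = quotient_comb scale W (k ` D) c" by (intro exI) (rule sym)
  qed
  then show ?thesis by (rule exI)
qed

theorem dim_plus_quotient_dim:
  assumes "subspace W"
  shows "dim W + quotient_dim scale W = dim UNIV"
  unfolding quotient_dim_def
  by (rule card_quotient_basis[OF assms someI_ex[OF quotient_basis_exists[OF assms]]])

end

end

theory Submission
  imports Defs
begin

text \<open>
  The proof compares \<open>ad x\<close>, for an \<open>x\<close> of maximal rank, with the other maps \<open>ad y\<close>. If the rank of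
  no map in the span of \<open>f\<close> and \<open>g\<close> exceeds that of \<open>f\<close>, then \<open>g\<close> should send \<open>ker f\<close> into the image
  of \<open>f\<close>: otherwise the sum of \<open>f\<close> and a generic multiple of \<open>g\<close> would have a larger image. A small
  field has no generic elements, but for rank two the maps \<open>g\<close>, \<open>f + g\<close> and \<open>f - g\<close> suffice: a
  determinant computation with them leads to \<open>2 = 0\<close> (lemma \<open>rank_two_kernel_into_range\<close>), and this
  is where the characteristic enters.

  Suppose that the breadth is \<open>2\<close> and is attained at \<open>x\<close>. Let \<open>I = [x, L]\<close> and let \<open>C\<close> be the
  centralizer of \<open>x\<close>, so that \<open>L\<close> is \<open>C\<close> plus the span of two elements \<open>a, b\<close>, and \<open>[L, C]\<close> lies in
  \<open>I\<close> by the above. Hence \<open>[L, L]\<close> is \<open>I\<close> plus the line through \<open>[a, b]\<close>, of dimension at most \<open>3\<close>.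
  If it is \<open>3\<close>, then \<open>p = [x, a]\<close>, \<open>q = [x, b]\<close>, \<open>r = [a, b]\<close> are independent, the images of
  \<open>ad a\<close>, \<open>ad b\<close>, \<open>ad (a + b)\<close> are the planes spanned by \<open>p, r\<close>, by \<open>q, r\<close> and by \<open>p + q, r\<close>, and
  these meet \<open>I\<close> in the lines through \<open>p\<close>, \<open>q\<close> and \<open>p + q\<close>. So for \<open>u\<close> in \<open>C\<close> the brackets
  \<open>[u, a]\<close>, \<open>[u, b]\<close> and \<open>[u, a + b]\<close> are multiples of \<open>p\<close>, \<open>q\<close> and \<open>p + q\<close>, necessarily with the
  same factor \<open>\<alpha>\<close>, and \<open>u - \<alpha> x\<close> commutes with \<open>x\<close>, \<open>a\<close> and \<open>b\<close>. Two elements that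
  commute with \<open>x\<close>, \<open>a\<close> and \<open>b\<close> have their bracket in all of \<open>[x, L]\<close>, \<open>[a, L]\<close> and \<open>[b, L]\<close>; these
  have intersection zero. So everything that commutes with \<open>x\<close>, \<open>a\<close> and \<open>b\<close> is central, and
  \<open>x, a, b\<close> is a basis of \<open>L\<close> modulo the center (lemma \<open>dim_center_of_breadth_two\<close>).

  Conversely, breadth at most \<open>1\<close> gives a derived algebra of dimension at most \<open>1\<close>, by the same
  argument with one vector in place of \<open>a, b\<close> (lemma \<open>dim_derived_le_one\<close>). The breadth is at most
  the dimension of \<open>[L, L]\<close>, and a center of codimension \<open>3\<close> also bounds it by \<open>2\<close>, because
  \<open>ad x\<close> vanishes on \<open>x\<close> as well as on the center (lemma \<open>rank_le_codim_center\<close>).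
\<close>

section \<open>Planes and independent pairs and triples\<close>

context finite_dimensional_vector_space
begin

text \<open>
  Independence of two or three vectors is expressed throughout by coefficients: unlike
  independence of the set of these vectors, it also excludes repetitions, and it permits comparison
  of coefficients.
\<close>

lemma dim_two_basis:
  assumes "subspace S" "dim S = 2"
  obtains v w where "v \<in> S" "w \<in> S" "S = span {v, w}"
    "\<forall>s t. s *s v + t *s w = 0 \<longrightarrow> s = 0 \<and> t = 0"
proof -
  obtain B where B: "B \<subseteq> S" "independent B" "S \<subseteq> span B" "card B = 2"
    using basis_exists[of S] assms(2) by metis
  then obtain v w where vw: "B = {v, w}" "v \<noteq> w" by (auto simp: card_2_iff)
  have "s = 0 \<and> t = 0" if "s *s v + t *s w = 0" for s t
  proof -
    define c where "c y = (if y = v then s else t)" for y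
    have "(\<Sum>y\<in>B. c y *s y) = 0" using vw that by (simp add: c_def)
    then have "\<forall>y\<in>B. c y = 0"
      using B(2) finiteI_independent[OF B(2)] by (auto simp: dependent_finite)
    then show ?thesis using vw by (simp add: c_def)
  qed
  moreover have "S = span {v, w}" using B assms(1) vw by (metis span_subspace)
  ultimately show ?thesis using that B(1) vw(1) by blast
qed

lemma mem_span_pair: "z \<in> span {v, w} \<longleftrightarrow> (\<exists>s t. z = s *s v + t *s w)"
  by (simp add: span_breakdown_eq[of z v] span_singleton image_iff diff_eq_eq add.commute)

lemma independent_pair:
  assumes "\<forall>s t. s *s v + t *s w = 0 \<longrightarrow> s = 0 \<and> t = 0"
  shows "v \<noteq> w" "independent {v, w}"
proof -
  have w: "w \<noteq> 0" using assms[rule_format, of 0 1] by auto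
  have v: "v \<notin> span {w}"
  proof
    assume "v \<in> span {w}"
    then obtain k where "v = k *s w" by (auto simp: span_singleton)
    then show False using assms[rule_format, of 1 "- k"] by simp
  qed
  then show "v \<noteq> w" using span_base[of w "{w}"] by auto
  show "independent {v, w}"
    by (intro independent_insertI v) (use w in \<open>simp_all add: span_empty independent_empty\<close>)
qed

lemma independent_triple:
  assumes "\<forall>s t k. s *s v + t *s w + k *s y = 0 \<longrightarrow> s = 0 \<and> t = 0 \<and> k = 0"
  shows "card {v, w, y} = 3" "independent {v, w, y}"
proof -
  have wy: "\<forall>s t. s *s w + t *s y = 0 \<longrightarrow> s = 0 \<and> t = 0"
    using assms[rule_format, of 0] by simp
  have v: "v \<notin> span {w, y}"
  proof
    assume "v \<in> span {w, y}"
    then obtain s t where "v = s *s w + t *s y" by (auto simp: mem_span_pair)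
    then show False using assms[rule_format, of 1 "- s" "- t"] by simp
  qed
  then have "v \<notin> {w, y}" using span_base by blast
  then show "card {v, w, y} = 3" using independent_pair(1)[OF wy] by simp
  show "independent {v, w, y}"
    using v independent_pair(2)[OF wy] by (rule independent_insertI)
qed

lemma independent_pair_extend:
  assumes S: "subspace S" "p \<in> S" "q \<in> S" and w: "w \<notin> S"
    and ind: "\<forall>s t. s *s p + t *s q = 0 \<longrightarrow> s = 0 \<and> t = 0"
  shows "\<forall>s t k. s *s p + t *s q + k *s w = 0 \<longrightarrow> s = 0 \<and> t = 0 \<and> k = 0"
proof (intro allI impI)
  fix s t k assume eq: "s *s p + t *s q + k *s w = 0"
  have "k = 0"
  proof (rule ccontr)
    assume k: "k \<noteq> 0"
    have "k *s w = - (s *s p + t *s q)" using eq by (metis add.commute eq_neg_iff_add_eq_0)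
    also have "\<dots> \<in> S" using S by (intro subspace_neg subspace_add subspace_scale)
    finally have "inverse k *s (k *s w) \<in> S" by (rule subspace_scale[OF S(1)])
    then show False using w k by simp
  qed
  then show "s = 0 \<and> t = 0 \<and> k = 0" using eq ind by simp
qed

lemma plane_eq_span_pair:
  assumes S: "subspace S" "dim S \<le> 2" and mem: "v \<in> S" "w \<in> S"
    and ind: "\<forall>s t. s *s v + t *s w = 0 \<longrightarrow> s = 0 \<and> t = 0"
  shows "dim S = 2" "S = span {v, w}"
proof -
  note i = independent_pair[OF ind]
  have c: "card {v, w} = 2" using i(1) by simp
  show 2: "dim S = 2" using independent_card_le_dim[of "{v, w}" S] i c mem S(2) by simp
  have "S \<subseteq> span {v, w}"
    using card_ge_dim_independent[of "{v, w}" S] i c mem 2 by simp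
  moreover have "span {v, w} \<subseteq> S" using mem S(1) by (intro span_minimal) auto
  ultimately show "S = span {v, w}" by (rule subset_antisym)
qed

text \<open>The coordinate at \<open>p\<close> with respect to a basis that extends the triple.\<close>

lemma linear_functional_dual_to_triple:
  assumes "\<forall>s t k. s *s p + t *s q + k *s w = 0 \<longrightarrow> s = 0 \<and> t = 0 \<and> k = 0"
  obtains \<phi> where "\<And>u v. \<phi> (u + v) = \<phi> u + \<phi> v" "\<And>c v. \<phi> (c *s v) = c * \<phi> v"
    "\<phi> p = 1" "\<phi> q = 0" "\<phi> w = (0 :: 'a)"
proof -
  note i = independent_triple[OF assms]
  define E where "E = extend_basis {p, q, w}"
  have E: "independent E" "span E = UNIV" "{p, q, w} \<subseteq> E"
    using extend_basis_superset independent_extend_basis span_extend_basis i(2)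
    unfolding E_def by auto
  have ne: "p \<noteq> q" "p \<noteq> w" using i(1) by (auto simp: card_insert_if split: if_splits)
  show ?thesis
    by (rule that[of "\<lambda>v. representation E v p"])
      (use E ne in \<open>simp_all add: representation_add representation_scale representation_basis\<close>)
qed

section \<open>Linear maps of bounded rank\<close>

text \<open>
  A map of rank at most two whose image contains \<open>w\<close> has rank at most one modulo \<open>w\<close>, so its
  \<open>2 \<times> 2\<close> minors modulo \<open>w\<close> vanish. Functionals that vanish at \<open>w\<close> play the part of the rows.
\<close>

lemma rank_two_minor:
  assumes h: "Vector_Spaces.linear scale scale h" "dim (range h) \<le> 2" "w \<in> range h" "w \<noteq> 0"
    and \<phi>: "\<And>u v. \<phi> (u + v) = \<phi> u + \<phi> v" "\<And>c v. \<phi> (c *s v) = c * \<phi> v" "\<phi> w = (0 :: 'a)"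
    and \<psi>: "\<And>u v. \<psi> (u + v) = \<psi> u + \<psi> v" "\<And>c v. \<psi> (c *s v) = c * \<psi> v" "\<psi> w = (0 :: 'a)"
  shows "\<phi> (h a) * \<psi> (h b) = \<phi> (h b) * \<psi> (h a)"
proof (rule ccontr)
  assume ne: "\<phi> (h a) * \<psi> (h b) \<noteq> \<phi> (h b) * \<psi> (h a)"
  interpret h: Vector_Spaces.linear scale scale h by fact
  have "s = 0 \<and> t = 0" if eq: "s *s h b + t *s w = 0" for s t
  proof -
    have z: "\<phi> 0 = 0" "\<psi> 0 = 0" using \<phi>(2)[of 0 0] \<psi>(2)[of 0 0] by simp_all
    have "s * \<phi> (h b) = 0" "s * \<psi> (h b) = 0"
      using arg_cong[OF eq, of \<phi>] arg_cong[OF eq, of \<psi>] \<phi> \<psi> z by simp_all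
    then have "s = 0" using ne by auto
    then show ?thesis using eq h(4) by simp
  qed
  then have "range h = span {h b, w}"
    using plane_eq_span_pair(2)[of "range h" "h b" w] h(2,3) h.subspace_image[OF subspace_UNIV]
    by blast
  then obtain s t where "h a = s *s h b + t *s w" using mem_span_pair by blast
  then show False using ne \<phi> \<psi> by simp
qed

text \<open>
  Suppose that \<open>w = g u\<close> is not in the image of \<open>f\<close>. It lies in the images of \<open>g\<close>, \<open>f + g\<close> and
  \<open>f - g\<close>, so these three maps have rank at most one modulo \<open>w\<close>, whereas \<open>f\<close> still has rank two
  there. For a suitable \<open>2 \<times> 2\<close> minor, \<open>det (f + t g)\<close> is a polynomial \<open>1 + c t + d t\<^sup>2\<close> with
  \<open>d = det g = 0\<close>. It vanishes at \<open>t = 1\<close> and at \<open>t = -1\<close>, and adding the two equations gives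
  \<open>2 = 0\<close>.
\<close>

lemma rank_two_kernel_into_range:
  assumes two: "(2 :: 'a) \<noteq> 0"
    and f: "Vector_Spaces.linear scale scale f" "dim (range f) = 2"
    and g: "Vector_Spaces.linear scale scale g" "dim (range g) \<le> 2"
    and add: "dim (range (\<lambda>v. f v + g v)) \<le> 2"
    and diff: "dim (range (\<lambda>v. f v - g v)) \<le> 2"
    and u: "f u = 0"
  shows "g u \<in> range f"
proof (rule ccontr)
  assume w: "g u \<notin> range f"
  interpret f: Vector_Spaces.linear scale scale f by fact
  interpret g: Vector_Spaces.linear scale scale g by fact
  have sub: "subspace (range f)" using f.subspace_image[OF subspace_UNIV] .
  obtain p q where pq: "p \<in> range f" "q \<in> range f"
    "\<forall>s t. s *s p + t *s q = 0 \<longrightarrow> s = 0 \<and> t = 0"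
    using dim_two_basis[OF sub f(2)] by metis
  then obtain a b where ab: "p = f a" "q = f b" by blast
  note ind = independent_pair_extend[OF sub pq(1,2) w pq(3)]
  have w0: "g u \<noteq> 0" using w subspace_0[OF sub] by metis
  \<comment> \<open>\<open>\<phi>\<close> and \<open>\<psi>\<close> are the coordinates at \<open>p\<close> and \<open>q\<close>, so the minor of \<open>f\<close> in them is the identity.\<close>
  obtain \<phi> where \<phi>: "\<And>u v. \<phi> (u + v) = \<phi> u + \<phi> v" "\<And>c v. \<phi> (c *s v) = c * \<phi> v"
    "\<phi> p = 1" "\<phi> q = 0" "\<phi> (g u) = (0 :: 'a)"
    using linear_functional_dual_to_triple[OF ind] by blast
  have ind': "\<forall>s t k. s *s q + t *s p + k *s g u = 0 \<longrightarrow> s = 0 \<and> t = 0 \<and> k = 0"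
    using ind by (metis add.commute)
  obtain \<psi> where \<psi>: "\<And>u v. \<psi> (u + v) = \<psi> u + \<psi> v" "\<And>c v. \<psi> (c *s v) = c * \<psi> v"
    "\<psi> q = 1" "\<psi> p = 0" "\<psi> (g u) = (0 :: 'a)"
    using linear_functional_dual_to_triple[OF ind'] by blast
  have neg: "\<phi> (- v) = - \<phi> v" "\<psi> (- v) = - \<psi> v" for v
    using \<phi>(2)[of "-1" v] \<psi>(2)[of "-1" v] by simp_all
  have minor: "\<phi> (h a) * \<psi> (h b) = \<phi> (h b) * \<psi> (h a)"
    if "Vector_Spaces.linear scale scale h" "dim (range h) \<le> 2" "g u \<in> range h" for h
    using rank_two_minor[OF that w0] \<phi>(1,2,5) \<psi>(1,2,5) by blast
  have G: "\<phi> (g a) * \<psi> (g b) = \<phi> (g b) * \<psi> (g a)"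
    using g by (intro minor) auto
  have lin: "Vector_Spaces.linear scale scale (\<lambda>v. f v + g v)"
    "Vector_Spaces.linear scale scale (\<lambda>v. f v - g v)"
    unfolding Vector_Spaces.linear_iff using vector_space_axioms
    by (simp_all add: f.add g.add f.scale g.scale algebra_simps)
  have "g u \<in> range (\<lambda>v. f v + g v)" by (rule range_eqI[of _ _ u]) (simp add: u)
  from minor[OF lin(1) add this]
  have A: "(1 + \<phi> (g a)) * (1 + \<psi> (g b)) = \<phi> (g b) * \<psi> (g a)"
    using \<phi> \<psi> ab by simp
  have "g u \<in> range (\<lambda>v. f v - g v)"
    by (rule range_eqI[of _ _ "- u"]) (simp add: u f.neg g.neg)
  from minor[OF lin(2) diff this]
  have D: "(1 - \<phi> (g a)) * (1 - \<psi> (g b)) = \<phi> (g b) * \<psi> (g a)"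
    unfolding diff_conv_add_uminus \<phi>(1) \<psi>(1) neg using \<phi> \<psi> ab by simp
  have "1 + (\<phi> (g a) + \<psi> (g b)) = 0" "1 - (\<phi> (g a) + \<psi> (g b)) = 0"
    using G A D by (simp_all add: algebra_simps)
  then have "(1 + (\<phi> (g a) + \<psi> (g b))) + (1 - (\<phi> (g a) + \<psi> (g b))) = 0" by simp
  then have "(2 :: 'a) = 0" by (simp add: algebra_simps)
  then show False using two by simp
qed

text \<open>
  If \<open>g u \<noteq> 0\<close>, it spans the images of \<open>g\<close> and of \<open>f + g\<close>, hence also that of the difference \<open>f\<close>.
\<close>

lemma rank_one_kernel_into_range:
  assumes f: "Vector_Spaces.linear scale scale f" "dim (range f) = 1"
    and g: "Vector_Spaces.linear scale scale g" "dim (range g) \<le> 1"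
    and add: "dim (range (\<lambda>v. f v + g v)) \<le> 1"
    and u: "f u = 0"
  shows "g u \<in> range f"
proof (cases "g u = 0")
  case True
  then show ?thesis using u by (metis rangeI)
next
  case False
  interpret f: Vector_Spaces.linear scale scale f by fact
  interpret g: Vector_Spaces.linear scale scale g by fact
  have line: "S \<subseteq> span {g u}" if "g u \<in> S" "dim S \<le> 1" for S
    using card_ge_dim_independent[of "{g u}" S] False that by simp
  have "g u = f u + g u" using u by simp
  then have "f v + g v \<in> span {g u}" for v using line[OF _ add] by blast
  moreover have "g v \<in> span {g u}" for v using line[OF _ g(2)] by blast
  ultimately have "(f v + g v) - g v \<in> span {g u}" for v by (intro span_diff)
  then have sub: "range f \<subseteq> span {g u}" by auto
  have "dim (span {g u}) = 1" using dim_span_eq_card_independent[of "{g u}"] False by simp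
  then have "range f = span {g u}"
    using subspace_dim_equal[OF f.subspace_image[OF subspace_UNIV] subspace_span sub] f(2) by simp
  then show ?thesis using span_base[of "g u" "{g u}"] by simp
qed

lemma dim_plus_rank_le:
  assumes f: "Vector_Spaces.linear scale scale f" and K: "subspace K" "\<And>v. v \<in> K \<Longrightarrow> f v = 0"
  shows "dim K + dim (range f) \<le> dim UNIV"
proof -
  interpret f: Vector_Spaces.linear scale scale f by fact
  obtain B where B: "B \<subseteq> K" "independent B" "K \<subseteq> span B" "card B = dim K"
    using basis_exists[of K] by metis
  obtain E where E: "B \<subseteq> E" "independent E" "UNIV \<subseteq> span E"
    using maximal_independent_subset_extend[OF subset_UNIV B(2)] by metis
  have fin: "finite E" using E(2) by (rule finiteI_independent)
  have "range f \<subseteq> span (f ` E)" using f.span_image[of E] E(3) by blast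
  also have "\<dots> \<subseteq> span (f ` (E - B))"
  proof (rule span_minimal)
    have "f e \<in> span (f ` (E - B))" if "e \<in> E" for e
      using that B(1) K(2) span_zero by (cases "e \<in> B") (auto intro: span_base)
    then show "f ` E \<subseteq> span (f ` (E - B))" by blast
  qed simp
  finally have "dim (range f) \<le> card (f ` (E - B))" using fin by (intro dim_le_card) auto
  also have "\<dots> \<le> card (E - B)" using fin by (intro card_image_le) auto
  also have "\<dots> = card E - card B" using fin E(1) by (meson card_Diff_subset finite_subset)
  finally show ?thesis
    using B(4) card_mono[OF fin E(1)] basis_card_eq_dim[OF subset_UNIV E(3,2)] by linarith
qed

lemma dim_complement_of_triple:
  assumes Z: "subspace Z"
    and gen: "\<And>v. \<exists>\<alpha> s t z. v = \<alpha> *s x + s *s a + t *s b + z \<and> z \<in> Z"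
    and ind: "\<And>\<alpha> s t. \<alpha> *s x + s *s a + t *s b \<in> Z \<Longrightarrow> \<alpha> = 0 \<and> s = 0 \<and> t = 0"
  shows "dim Z + 3 = dim UNIV"
proof -
  let ?U = "span {x, a, b}"
  have U: "y \<in> ?U \<longleftrightarrow> (\<exists>\<alpha> s t. y = \<alpha> *s x + s *s a + t *s b)" for y
    unfolding span_breakdown_eq[of y x] mem_span_pair by (simp add: diff_eq_eq ac_simps)
  have "\<forall>\<alpha> s t. \<alpha> *s x + s *s a + t *s b = 0 \<longrightarrow> \<alpha> = 0 \<and> s = 0 \<and> t = 0"
    using ind subspace_0[OF Z] by metis
  from independent_triple[OF this] have "dim ?U = 3"
    using dim_span_eq_card_independent by simp
  moreover have "?U \<inter> Z = {0}"
  proof (intro equalityI subsetI)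
    fix y assume "y \<in> ?U \<inter> Z"
    then obtain \<alpha> s t where y: "y = \<alpha> *s x + s *s a + t *s b" "y \<in> Z" by (auto simp: U)
    then show "y \<in> {0}" using ind[of \<alpha> s t] by simp
  qed (simp add: subspace_0[OF Z] span_zero)
  moreover have "{y + z |y z. y \<in> ?U \<and> z \<in> Z} = UNIV"
    using gen unfolding U by blast
  moreover have "dim {0} = 0" by (subst dim_eq_0) simp
  ultimately show ?thesis
    using dim_sums_Int[of ?U Z] Z by simp
qed

end

section \<open>Brackets and the ranks of the adjoint maps\<close>

context lie_algebra
begin

lemma ad_linear: "Vector_Spaces.linear scale scale (ad x)"
  using linear_right by (simp add: ad_def)

lemma bracket_add_left: "bracket (x + y) z = bracket x z + bracket y z"
  and bracket_scale_left: "bracket (c *s x) z = c *s bracket x z"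
  using linear_left[of z] by (simp_all add: Vector_Spaces.linear_iff)

lemma bracket_add_right: "bracket x (y + z) = bracket x y + bracket x z"
  and bracket_scale_right: "bracket x (c *s y) = c *s bracket x y"
  using linear_right[of x] by (simp_all add: Vector_Spaces.linear_iff)

lemma bracket_neg_left: "bracket (- x) z = - bracket x z"
  using bracket_scale_left[of "-1"] by simp

lemma bracket_neg_right: "bracket x (- z) = - bracket x z"
  using bracket_scale_right[of _ "-1"] by simp

lemma bracket_diff_left: "bracket (x - y) z = bracket x z - bracket y z"
  unfolding diff_conv_add_uminus bracket_add_left bracket_neg_left ..

lemma bracket_diff_right: "bracket x (y - z) = bracket x y - bracket x z"
  unfolding diff_conv_add_uminus bracket_add_right bracket_neg_right ..

lemma bracket_zero [simp]: "bracket 0 z = 0" "bracket z 0 = 0"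
  using bracket_scale_left[of 0] bracket_scale_right[of _ 0] by simp_all

lemma bracket_anticommute: "bracket y x = - bracket x y"
proof -
  have "bracket (x + y) (x + y) = bracket x y + bracket y x"
    unfolding bracket_add_left bracket_add_right by (simp add: bracket_self)
  then show ?thesis by (metis bracket_self add.commute eq_neg_iff_add_eq_0)
qed

lemmas bracket_expand = bracket_add_left bracket_add_right bracket_scale_left bracket_scale_right
  bracket_diff_left bracket_diff_right bracket_self

lemma subspace_center: "subspace center"
  by (simp add: subspace_def center_def bracket_add_left bracket_scale_left)

lemma subspace_range_ad: "subspace (range (ad x))"
proof -
  interpret ad: Vector_Spaces.linear scale scale "ad x" by (rule ad_linear)
  show ?thesis by (rule ad.subspace_image[OF subspace_UNIV])
qed

lemma mem_range_ad: "bracket x y \<in> range (ad x)" "bracket y x \<in> range (ad x)"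
proof -
  show "bracket x y \<in> range (ad x)" by (simp add: ad_def)
  then show "bracket y x \<in> range (ad x)"
    unfolding bracket_anticommute[of y x] by (rule subspace_neg[OF subspace_range_ad])
qed

lemma range_ad_subset_derived: "range (ad x) \<subseteq> derived_algebra"
  unfolding derived_algebra_def bracket_space_def ad_def by (auto intro: span_base)

lemma derived_algebra_subset:
  assumes "subspace S" "\<And>v w. bracket v w \<in> S"
  shows "derived_algebra \<subseteq> S"
  unfolding derived_algebra_def bracket_space_def using assms by (intro span_minimal) auto

end

text \<open>
  Finite dimension is provided here by a fixed basis, since the dimension theory of
  \<^locale>\<open>finite_dimensional_vector_space\<close> has a basis as a parameter.
\<close>

locale lie_algebra_with_basis =
  lie_algebra scale bracket + finite_dimensional_vector_space scale Basis
  for scale :: "'f::field \<Rightarrow> 'a::ab_group_add \<Rightarrow> 'a" (infixr \<open>*s\<close> 75)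
    and bracket and Basis
begin

sublocale finite_dimensional_lie_algebra scale bracket
  by unfold_locales (use finite_dimensional_vector_space_axioms in blast)

lemma finite_ranks: "finite {dim (range (ad x)) | x. True}"
  by (rule finite_subset[of _ "{..dimension}"]) (auto simp: dim_subset_UNIV)

lemma rank_le_breadth: "dim (range (ad x)) \<le> breadth"
  unfolding breadth_def by (rule Max_ge[OF finite_ranks]) blast

lemma breadth_attained: obtains x where "dim (range (ad x)) = breadth"
proof -
  have "breadth \<in> {dim (range (ad x)) | x. True}"
    unfolding breadth_def by (rule Max_in[OF finite_ranks]) blast
  then show ?thesis using that by auto
qed

lemma breadth_le_dim_derived: "breadth \<le> dim derived_algebra"
  using breadth_attained dim_subset[OF range_ad_subset_derived] by metis

text \<open>
  If \<open>ad x\<close> has rank one, its kernel \<open>C\<close> is a hyperplane and \<open>L\<close> is \<open>C\<close> plus the line through some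
  \<open>a\<close>. Since \<open>[L, C]\<close> lies in \<open>[x, L]\<close> and \<open>[a, a] = 0\<close>, so does \<open>[L, L]\<close>.
\<close>

lemma dim_derived_le_one:
  assumes b: "breadth \<le> 1"
  shows "dim derived_algebra \<le> 1"
proof -
  have rank: "dim (range (ad y)) \<le> 1" for y using rank_le_breadth[of y] b by simp
  obtain x where x: "dim (range (ad x)) = breadth" by (rule breadth_attained)
  show ?thesis
  proof (cases "breadth = 0")
    case True
    then have "dim (range (ad y)) = 0" for y using rank_le_breadth[of y] by simp
    then have "range (ad y) \<subseteq> {0}" for y by (simp only: dim_eq_0)
    then have "bracket y z = 0" for y z using mem_range_ad(1)[of y z] by blast
    then have "derived_algebra \<subseteq> {0}" by (intro derived_algebra_subset) (auto simp: subspace_0)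
    then have "dim derived_algebra = 0" by (simp only: dim_eq_0)
    then show ?thesis by linarith
  next
    case False
    with b x have one: "dim (range (ad x)) = 1" by simp
    have ker: "bracket y u \<in> range (ad x)" if "bracket x u = 0" for y u
    proof -
      have "dim (range (\<lambda>v. ad x v + ad y v)) \<le> 1"
        using rank[of "x + y"] by (simp add: ad_def bracket_add_left[symmetric])
      then have "ad y u \<in> range (ad x)"
        by (rule rank_one_kernel_into_range[OF ad_linear one ad_linear rank]) (simp add: ad_def that)
      then show ?thesis by (simp add: ad_def)
    qed
    obtain p where p: "p \<noteq> 0" "p \<in> range (ad x)"
      using one dim_eq_0[of "range (ad x)"] by auto
    have "range (ad x) \<subseteq> span {p}"
      using card_ge_dim_independent[of "{p}" "range (ad x)"] p one by simp
    moreover obtain a where a: "p = bracket x a" using p(2) by (auto simp: ad_def)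
    ultimately have split: "\<exists>k. bracket x (v - k *s a) = 0" for v
      using mem_range_ad(1)[of x v] by (fastforce simp: span_singleton bracket_expand)
    have "bracket v w \<in> range (ad x)" for v w
    proof -
      obtain k l where kl: "bracket x (v - k *s a) = 0" "bracket x (w - l *s a) = 0"
        using split by metis
      have "bracket v w = bracket v (w - l *s a) - l *s bracket a (v - k *s a)"
        by (simp add: bracket_expand bracket_anticommute[of v a])
      also have "\<dots> \<in> range (ad x)"
        by (intro subspace_diff subspace_scale subspace_range_ad ker kl)
      finally show ?thesis .
    qed
    then have "dim derived_algebra \<le> dim (range (ad x))"
      by (intro dim_subset derived_algebra_subset subspace_range_ad)
    then show ?thesis using one by simp
  qed
qed

lemma centralizer_bracket_into_range:
  assumes two: "(2 :: 'f) \<noteq> 0" and rank: "\<And>y. dim (range (ad y)) \<le> 2"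
    and x: "dim (range (ad x)) = 2" and u: "bracket x u = 0"
  shows "bracket u y \<in> range (ad x)" "bracket y u \<in> range (ad x)"
proof -
  have "dim (range (\<lambda>v. ad x v + ad y v)) \<le> 2" "dim (range (\<lambda>v. ad x v - ad y v)) \<le> 2"
    using rank[of "x + y"] rank[of "x - y"]
    by (simp_all add: ad_def bracket_add_left[symmetric] bracket_diff_left[symmetric])
  then have "ad y u \<in> range (ad x)"
    by (rule rank_two_kernel_into_range[OF two ad_linear x ad_linear rank]) (simp add: ad_def u)
  then show "bracket y u \<in> range (ad x)" by (simp add: ad_def)
  then show "bracket u y \<in> range (ad x)"
    unfolding bracket_anticommute[of u y] by (rule subspace_neg[OF subspace_range_ad])
qed

section \<open>Breadth two\<close>

lemma rank_two_splitting:
  assumes "dim (range (ad x)) = 2"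
  obtains a b where "range (ad x) = span {bracket x a, bracket x b}"
    "\<forall>s t. s *s bracket x a + t *s bracket x b = 0 \<longrightarrow> s = 0 \<and> t = 0"
    "\<And>v. \<exists>s t u. bracket x u = 0 \<and> v = s *s a + t *s b + u"
proof -
  obtain p q where pq: "p \<in> range (ad x)" "q \<in> range (ad x)" "range (ad x) = span {p, q}"
    "\<forall>s t. s *s p + t *s q = 0 \<longrightarrow> s = 0 \<and> t = 0"
    using dim_two_basis[OF subspace_range_ad assms] by metis
  then obtain a b where ab: "p = bracket x a" "q = bracket x b" unfolding ad_def by blast
  have "\<exists>s t u. bracket x u = 0 \<and> v = s *s a + t *s b + u" for v
  proof -
    obtain s t where "bracket x v = s *s p + t *s q"
      using mem_range_ad(1)[of x v] pq(3) mem_span_pair by blast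
    then have "bracket x (v - (s *s a + t *s b)) = 0" by (simp add: bracket_expand ab)
    moreover have "v = s *s a + t *s b + (v - (s *s a + t *s b))" by simp
    ultimately show ?thesis by blast
  qed
  then show ?thesis by (rule that[OF pq(3,4)[unfolded ab]])
qed

text \<open>
  The independence of \<open>[x, a]\<close>, \<open>[x, b]\<close>, \<open>[a, b]\<close> makes the situation symmetric in \<open>x\<close>, \<open>a\<close> and \<open>b\<close>:
  each has rank two, so the brackets of an element that commutes with one of them lie in the image
  of that one. Since the three images have intersection zero, an element that commutes with all
  three is central.
\<close>

lemma dim_center_of_breadth_two:
  assumes two: "(2 :: 'f) \<noteq> 0" and b: "breadth = 2" and d: "dim derived_algebra \<noteq> 2"
  shows "dim derived_algebra = 3" "dim center + 3 = dim UNIV"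
proof -
  have rank: "dim (range (ad y)) \<le> 2" for y using rank_le_breadth[of y] b by simp
  obtain x where x: "dim (range (ad x)) = 2" using breadth_attained b by metis
  note cent = centralizer_bracket_into_range[OF two rank]
  obtain a b where ab: "range (ad x) = span {bracket x a, bracket x b}"
    "\<forall>s t. s *s bracket x a + t *s bracket x b = 0 \<longrightarrow> s = 0 \<and> t = 0"
    "\<And>v. \<exists>s t u. bracket x u = 0 \<and> v = s *s a + t *s b + u"
    by (rule rank_two_splitting[OF x]) blast
  define p q r where pqr: "p = bracket x a" "q = bracket x b" "r = bracket a b"
  have ba: "bracket b a = - r" unfolding pqr by (rule bracket_anticommute)
  have derived: "derived_algebra \<subseteq> span {r, p, q}"
  proof (rule derived_algebra_subset)
    fix v w
    obtain s t u where v: "bracket x u = 0" "v = s *s a + t *s b + u" using ab(3) by metis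
    obtain s' t' u' where w: "bracket x u' = 0" "w = s' *s a + t' *s b + u'" using ab(3) by metis
    have "bracket v w = (s * t' - t * s') *s r
        + (bracket u (s' *s a + t' *s b) + bracket v u')"
      unfolding v(2) w(2) by (simp add: bracket_expand ba pqr(3)[symmetric] algebra_simps)
    moreover have "bracket u (s' *s a + t' *s b) + bracket v u' \<in> span {p, q}"
      unfolding pqr(1,2) ab(1)[symmetric]
      by (intro subspace_add subspace_range_ad cent[OF x v(1)] cent[OF x w(1)])
    ultimately show "bracket v w \<in> span {r, p, q}"
      unfolding span_breakdown_eq[of _ r]
      by (intro exI[of _ "s * t' - t * s'"]) simp
  qed simp
  have r: "r \<notin> span {p, q}"
  proof
    assume "r \<in> span {p, q}"
    then have "span {r, p, q} = range (ad x)" using span_redundant ab(1) pqr by metis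
    then have "dim derived_algebra \<le> 2" using dim_subset[OF derived] x by simp
    then show False using d breadth_le_dim_derived b by simp
  qed
  have pq: "s = 0 \<and> t = 0" if "s *s p + t *s q = 0" for s t using ab(2) that unfolding pqr by blast
  have ind: "s = 0 \<and> t = 0 \<and> k = 0" if "s *s p + t *s q + k *s r = 0" for s t k
    using independent_pair_extend[of "span {p, q}" p q r] r pq that by (simp add: span_base)
  have "dim (span {p, q, r}) = 3"
    using dim_span_eq_card_independent[of "{p, q, r}"] independent_triple[of p q r] ind by metis
  moreover have "{p, q, r} = {r, p, q}" by auto
  ultimately have "dim derived_algebra \<le> 3" using dim_subset[OF derived] by simp
  then show "dim derived_algebra = 3" using d breadth_le_dim_derived b by simp

  have I: "\<exists>s t. z = s *s p + t *s q" if "z \<in> range (ad x)" for z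
    using that ab(1) pqr mem_span_pair by metis
  have plane: "dim (range (ad y)) = 2" "range (ad y) = span {v, w}"
    if "v \<in> range (ad y)" "w \<in> range (ad y)" "\<forall>s t. s *s v + t *s w = 0 \<longrightarrow> s = 0 \<and> t = 0"
    for y v w
    using plane_eq_span_pair[OF subspace_range_ad rank that] by blast+
  have ind_pr: "\<forall>s t. s *s p + t *s r = 0 \<longrightarrow> s = 0 \<and> t = 0"
    and ind_qr: "\<forall>s t. s *s q + t *s r = 0 \<longrightarrow> s = 0 \<and> t = 0"
    and ind_pqr: "\<forall>s t. s *s (p + q) + t *s r = 0 \<longrightarrow> s = 0 \<and> t = 0"
    using ind[of _ 0] ind[of 0] ind by (simp_all add: scale_right_distrib)
  have mem: "p \<in> range (ad a)" "r \<in> range (ad a)" "q \<in> range (ad b)" "r \<in> range (ad b)"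
    unfolding pqr by (rule mem_range_ad)+
  have "bracket x (a + b) = p + q" "bracket a (a + b) = r"
    by (simp_all add: pqr bracket_expand)
  then have mem': "p + q \<in> range (ad (a + b))" "r \<in> range (ad (a + b))"
    using mem_range_ad(2) by metis+
  have A: "\<exists>s t. z = s *s p + t *s r" if "z \<in> range (ad a)" for z
    using that plane(2)[OF mem(1,2) ind_pr] mem_span_pair by simp
  have B: "\<exists>s t. z = s *s q + t *s r" if "z \<in> range (ad b)" for z
    using that plane(2)[OF mem(3,4) ind_qr] mem_span_pair by simp
  \<comment> \<open>The image of \<open>ad (a + b)\<close> serves to identify the factors of \<open>p\<close> and \<open>q\<close> found from \<open>a\<close> and \<open>b\<close>.\<close>
  have AB: "\<exists>s t. z = s *s (p + q) + t *s r" if "z \<in> range (ad (a + b))" for z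
    using that plane(2)[OF mem' ind_pqr] mem_span_pair by simp
  have ra: "dim (range (ad a)) = 2" "dim (range (ad b)) = 2"
    using plane(1)[OF mem(1,2) ind_pr] plane(1)[OF mem(3,4) ind_qr] .

  have uniq: "s = s' \<and> t = t' \<and> k = k'"
    if "s *s p + t *s q + k *s r = s' *s p + t' *s q + k' *s r" for s t k s' t' k'
  proof -
    have "(s - s') *s p + (t - t') *s q + (k - k') *s r
        = (s *s p + t *s q + k *s r) - (s' *s p + t' *s q + k' *s r)"
      by (simp add: algebra_simps)
    then have "(s - s') *s p + (t - t') *s q + (k - k') *s r = 0" unfolding that by simp
    from ind[OF this] show ?thesis by simp
  qed

  define D where "D = {z. bracket x z = 0 \<and> bracket z a = 0 \<and> bracket z b = 0}"
  have C: "\<exists>\<alpha> z. u = \<alpha> *s x + z \<and> z \<in> D" if u: "bracket x u = 0" for u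
  proof -
    obtain s1 t1 where 1: "bracket u a = s1 *s p + t1 *s q" using I[OF cent(1)[OF x u]] by blast
    obtain s2 k2 where 2: "bracket u a = s2 *s p + k2 *s r" using A[OF mem_range_ad(2)] by blast
    obtain s3 t3 where 3: "bracket u b = s3 *s p + t3 *s q" using I[OF cent(1)[OF x u]] by blast
    obtain s4 k4 where 4: "bracket u b = s4 *s q + k4 *s r" using B[OF mem_range_ad(2)] by blast
    obtain s5 k5 where 5: "bracket u (a + b) = s5 *s (p + q) + k5 *s r"
      using AB[OF mem_range_ad(2)] by blast
    have ua: "bracket u a = s1 *s p" using uniq[of s1 t1 0 s2 0 k2] 1 2 by simp
    have ub: "bracket u b = t3 *s q" using uniq[of s3 t3 0 0 s4 k4] 3 4 by simp
    have "s1 = t3"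
      using uniq[of s1 t3 0 s5 s5 k5] 5 ua ub by (simp add: bracket_add_right scale_right_distrib)
    then have "u - s1 *s x \<in> D" using u ua ub by (simp add: D_def bracket_expand pqr)
    moreover have "u = s1 *s x + (u - s1 *s x)" by simp
    ultimately show ?thesis by blast
  qed
  have gen: "\<exists>\<alpha> s t z. v = \<alpha> *s x + s *s a + t *s b + z \<and> z \<in> D" for v
  proof -
    obtain s t u where v: "bracket x u = 0" "v = s *s a + t *s b + u" using ab(3) by metis
    obtain \<alpha> z where "u = \<alpha> *s x + z" "z \<in> D" using C[OF v(1)] by blast
    then have "v = \<alpha> *s x + s *s a + t *s b + z \<and> z \<in> D" using v(2) by (simp add: ac_simps)
    then show ?thesis by blast
  qed
  \<comment> \<open>The planes spanned by \<open>p, q\<close>, by \<open>p, r\<close> and by \<open>q, r\<close> have only \<open>0\<close> in common.\<close>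
  have DD: "bracket z z' = 0" if z: "z \<in> D" "z' \<in> D" for z z'
  proof -
    have c: "bracket x z = 0" "bracket a z = 0" "bracket b z = 0"
      using z(1) bracket_anticommute[of a z] bracket_anticommute[of b z] by (simp_all add: D_def)
    obtain s1 t1 where 1: "bracket z z' = s1 *s p + t1 *s q" using I[OF cent(1)[OF x c(1)]] by blast
    obtain s2 k2 where 2: "bracket z z' = s2 *s p + k2 *s r"
      using A[OF cent(1)[OF ra(1) c(2)]] by blast
    obtain s3 k3 where 3: "bracket z z' = s3 *s q + k3 *s r"
      using B[OF cent(1)[OF ra(2) c(3)]] by blast
    show ?thesis using uniq[of s1 t1 0 s2 0 k2] uniq[of s1 t1 0 0 s3 k3] 1 2 3 by simp
  qed
  have "D \<subseteq> center"
  proof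
    fix z assume z: "z \<in> D"
    have "bracket z v = 0" for v
    proof -
      obtain \<alpha> s t z' where v: "v = \<alpha> *s x + s *s a + t *s b + z'" "z' \<in> D" using gen by blast
      have "bracket z x = 0" using z bracket_anticommute[of z x] by (simp add: D_def)
      then show ?thesis using z DD[OF z v(2)] by (simp add: v(1) bracket_expand D_def)
    qed
    then show "z \<in> center" by (simp add: center_def)
  qed
  with gen have gen': "\<exists>\<alpha> s t z. v = \<alpha> *s x + s *s a + t *s b + z \<and> z \<in> center" for v
    by blast
  show "dim center + 3 = dim UNIV"
  proof (rule dim_complement_of_triple[OF subspace_center gen'])
    fix \<alpha> s t assume "\<alpha> *s x + s *s a + t *s b \<in> center"
    then have c: "bracket (\<alpha> *s x + s *s a + t *s b) y = 0" for y by (simp add: center_def)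
    have "bracket a x = - p" "bracket b x = - q" unfolding pqr by (rule bracket_anticommute)+
    then have "- s *s p + - t *s q = 0" using c[of x] by (simp add: bracket_expand)
    then have st: "s = 0" "t = 0" using pq[of "- s" "- t"] by simp_all
    then have "\<alpha> *s p + 0 *s q = 0" using c[of a] by (simp add: bracket_expand pqr)
    then show "\<alpha> = 0 \<and> s = 0 \<and> t = 0" using pq st by blast
  qed
qed

text \<open>
  The successor accounts for \<open>x\<close> itself: if it is not central, the kernel of \<open>ad x\<close> exceeds the
  center.
\<close>

lemma rank_le_codim_center:
  assumes "dim center + Suc n = dim UNIV"
  shows "dim (range (ad x)) \<le> n"
proof (cases "x \<in> center")
  case True
  then have "range (ad x) \<subseteq> {0}" by (auto simp: center_def ad_def)
  then have "dim (range (ad x)) = 0" by (simp only: dim_eq_0)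
  then show ?thesis by linarith
next
  case False
  have sp: "span center = center" using subspace_center by simp
  have "dim (insert x center) = dim center + 1"
    unfolding dim_insert sp using False by simp
  moreover have "dim (span (insert x center)) + dim (range (ad x)) \<le> dim UNIV"
  proof (rule dim_plus_rank_le[OF ad_linear subspace_span])
    fix v assume "v \<in> span (insert x center)"
    then obtain k where "v - k *s x \<in> center"
      unfolding span_breakdown_eq sp by blast
    then have "bracket (v - k *s x) x = 0" by (simp add: center_def)
    then have "bracket v x = 0" by (simp add: bracket_expand)
    then show "ad x v = 0" using bracket_anticommute[of x v] by (simp add: ad_def)
  qed
  ultimately show ?thesis using assms by simp
qed

theorem breadth_two_iff:
  assumes two: "(2 :: 'f) \<noteq> 0"
  shows "breadth = 2 \<longleftrightarrow> dim derived_algebra = 2 \<or>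
    (dim derived_algebra = 3 \<and> dim center + 3 = dim UNIV)"
proof
  assume "breadth = 2"
  then show "dim derived_algebra = 2 \<or> (dim derived_algebra = 3 \<and> dim center + 3 = dim UNIV)"
    using dim_center_of_breadth_two[OF two] by blast
next
  assume cases: "dim derived_algebra = 2 \<or> (dim derived_algebra = 3 \<and> dim center + 3 = dim UNIV)"
  then have "\<not> breadth \<le> 1" using dim_derived_le_one by auto
  moreover have "breadth \<le> 2"
    using cases
  proof
    assume "dim derived_algebra = 2"
    then show ?thesis using breadth_le_dim_derived by simp
  next
    assume "dim derived_algebra = 3 \<and> dim center + 3 = dim UNIV"
    then show ?thesis
      using rank_le_codim_center[of 2] breadth_attained by (metis numeral_3_eq_3 numeral_2_eq_2)
  qed
  ultimately show "breadth = 2" by simp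
qed

end

theorem theorem3p1:
  fixes scale :: "'f::field \<Rightarrow> 'a::ab_group_add \<Rightarrow> 'a"
    and bracket :: "'a \<Rightarrow> 'a \<Rightarrow> 'a"
  assumes "CHAR('f) \<noteq> 2"
    and "finite_dimensional_lie_algebra scale bracket"
    and "lie_algebra.nilpotent scale bracket"
  shows "finite_dimensional_lie_algebra.breadth scale bracket = 2 \<longleftrightarrow>
    vector_space.dim scale (lie_algebra.derived_algebra scale bracket) = 2 \<or>
    (vector_space.dim scale (lie_algebra.derived_algebra scale bracket) = 3 \<and>
     quotient_dim scale (lie_algebra.center bracket) = 3)"
proof -
  interpret L: finite_dimensional_lie_algebra scale bracket by fact
  obtain B where "finite_dimensional_vector_space scale B" using L.finite_dimensional by blast
  then interpret F: finite_dimensional_vector_space scale B .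
  interpret lie_algebra_with_basis scale bracket B ..
  have "\<not> CHAR('f) dvd 2"
  proof
    assume dvd: "CHAR('f) dvd 2"
    then have "CHAR('f) \<le> 2" by (rule dvd_imp_le) simp
    moreover have "CHAR('f) \<noteq> 0" using dvd by (metis dvd_0_left zero_neq_numeral)
    ultimately show False using assms(1) CHAR_not_1[where 'a = 'f] by linarith
  qed
  then have "(2 :: 'f) \<noteq> 0" using of_nat_eq_0_iff_char_dvd[of 2, where 'a = 'f] by simp
  then show ?thesis
    using breadth_two_iff F.dim_plus_quotient_dim[OF L.subspace_center] by auto
qed

end
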